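(* Let $D \subset \mathbb{C}$ be a convex domain and let $f : D \to \mathbb{C}$ be a non-constant analytic function. If there exists an analytic function $g : D \to \mathbb{C}$, univalent in $D$, such that $$|f'(z) - g'(z)| \leq K(g, D) \quad \text{for all } z \in D,$$ then the function $f$ is also univalent in $D$.
   Context: A domain is a nonempty connected open subset of $\mathbb{C}$. A function is univalent in a domain $D$ if it is analytic and injective in $D$. For an analytic function $h : D \to \mathbb{C}$ in a domain $D$, define $$K(h, D) = \inf_{\substack{a, b \in D \\ a \neq b}} \left| \frac{h(a) - h(b)}{a - b} \right|.$$ *)

theory Defs
  imports "HOL-Analysis.Analysis"
begin

definition complex_domain :: "complex set \<Rightarrow> bool" where
  "complex_domain D \<longleftrightarrow> D \<noteq> {} \<and> connected D \<and> open D"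

definition univalent_on :: "(complex \<Rightarrow> complex) \<Rightarrow> complex set \<Rightarrow> bool" where
  "univalent_on f D \<longleftrightarrow> f analytic_on D \<and> inj_on f D"

text \<open>The infimum is taken in the reals. It is the genuine one when \<open>D\<close> has at least two
  points, as every domain does: the set of quotients is then nonempty, and it is bounded below by 0.\<close>

definition K_inf :: "(complex \<Rightarrow> complex) \<Rightarrow> complex set \<Rightarrow> real" where
  "K_inf h D = (INF (a, b)\<in>{(a, b). a \<in> D \<and> b \<in> D \<and> a \<noteq> b}. cmod ((h a - h b) / (a - b)))"

end

theory Submission
  imports Defs "HOL-Complex_Analysis.Complex_Analysis"
begin

text \<open>
  Put \<open>\<phi> = f - g\<close> and \<open>K = K(g, D)\<close>. By convexity \<open>\<bar>\<phi> z - \<phi> b\<bar> \<le> K \<bar>z - b\<bar> \<le> \<bar>g z - g b\<bar>\<close>, so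
  for fixed \<open>b\<close> the quotient \<open>(\<phi> z - \<phi> b) / (g z - g b)\<close> is holomorphic on \<open>D - {b}\<close> and bounded
  by 1 in modulus. If \<open>f a = f b\<close> for some \<open>a \<noteq> b\<close>, it takes the value \<open>-1\<close> at \<open>a\<close>, hence is
  identically \<open>-1\<close> by the maximum modulus principle, which says that \<open>f\<close> is constant.
\<close>

text \<open>Clearing the denominator from the infimum bound admits the case \<open>a = b\<close>,
  where both sides are 0.\<close>

lemma K_inf_le:
  assumes "a \<in> D" "b \<in> D"
  shows "K_inf h D * cmod (a - b) \<le> cmod (h a - h b)"
proof (cases "a = b")
  case False
  have "K_inf h D \<le> cmod ((h a - h b) / (a - b))"
    unfolding K_inf_def using False assms
    by (intro cINF_lower2[where x = "(a, b)"] bdd_belowI2[where m = 0]) auto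
  with False show ?thesis
    by (simp add: norm_divide field_simps)
qed simp

theorem theorem2p4:
  fixes D :: "complex set" and f :: "complex \<Rightarrow> complex"
  assumes "complex_domain D" and "convex D"
    and "f analytic_on D" and "\<not> f constant_on D"
    and "\<exists>g. univalent_on g D \<and> (\<forall>z\<in>D. cmod (deriv f z - deriv g z) \<le> K_inf g D)"
  shows "univalent_on f D"
proof -
  from assms(5) obtain g where g: "g analytic_on D" "inj_on g D"
    and bound: "\<And>z. z \<in> D \<Longrightarrow> cmod (deriv f z - deriv g z) \<le> K_inf g D"
    by (auto simp: univalent_on_def)
  have D: "open D" "connected D"
    using assms(1) by (auto simp: complex_domain_def)
  have holo: "f holomorphic_on D" "g holomorphic_on D"
    using assms(3) g(1) by (auto intro: analytic_imp_holomorphic)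
  define \<phi> where "\<phi> = (\<lambda>z. f z - g z)"
  have \<phi>_deriv: "(\<phi> has_field_derivative deriv f z - deriv g z) (at z within D)" if "z \<in> D" for z
    unfolding \<phi>_def using holomorphic_derivI[OF holo(1) D(1) that] holomorphic_derivI[OF holo(2) D(1) that]
    by (intro DERIV_diff)
  have \<phi>_le: "cmod (\<phi> z - \<phi> b) \<le> cmod (g z - g b)" if "z \<in> D" "b \<in> D" for z b
    using field_differentiable_bound[OF assms(2) \<phi>_deriv bound that] K_inf_le[OF that, of g] 
    by linarith
  have "inj_on f D"
  proof (rule inj_onI, rule ccontr)
    fix a b assume ab: "a \<in> D" "b \<in> D" "f a = f b" "a \<noteq> b"
    have g_neq: "g z \<noteq> g b" if "z \<in> D - {b}" for z
      using g(2) ab(2) that by (auto dest: inj_onD)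
    define q where "q = (\<lambda>z. (\<phi> z - \<phi> b) / (g z - g b))"
    \<comment> \<open>Since \<open>f a = f b\<close>, the \<open>f\<close> terms cancel in
      \<open>\<phi> a - \<phi> b\<close>, leaving \<open>-(g a - g b)\<close>.\<close>
    have q_a: "q a = -1"
      using g_neq[of a] ab by (auto simp: q_def \<phi>_def field_simps)
    have "q constant_on D - {b}"
    proof (rule maximum_modulus_principle[where U = "D - {b}" and \<xi> = a])
      show "q holomorphic_on D - {b}"
        unfolding q_def \<phi>_def using g_neq holo
        by (intro holomorphic_intros) (auto intro: holomorphic_on_subset)
      \<comment> \<open>Removing a point from a connected open set in real dimension 2 keeps it
        connected.\<close>
      show "connected (D - {b})"
        using D by (intro connected_open_delete) auto
      show "cmod (q z) \<le> cmod (q a)" if "z \<in> D - {b}" for z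
        using \<phi>_le[of z b] that ab(2) g_neq[OF that]
        by (simp add: q_a) (simp add: q_def norm_divide divide_le_eq)
    qed (use D ab in auto)
    then have q_eq: "q z = -1" if "z \<in> D - {b}" for z
      using that ab q_a by (force simp: constant_on_def)
    \<comment> \<open>For \<open>z \<noteq> b\<close>, \<open>q z = -1\<close> reads
      \<open>\<phi> z - \<phi> b = -(g z - g b)\<close>, and the \<open>g\<close> terms
      cancel.\<close>
    have "f z = f b" if "z \<in> D" for z
    proof (cases "z = b")
      case False
      then show ?thesis
        using q_eq[of z] g_neq[of z] that by (simp add: q_def \<phi>_def divide_eq_eq)
    qed simp
    then show False
      using assms(4) by (auto simp: constant_on_def)
  qed
  with assms(3) show ?thesis
    by (simp add: univalent_on_def)
qed

end
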